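(* Let $q$ be a prime power and let $G\in\mathbb{F}_q^{2\times n}$ be a systematic MDS matrix. Suppose $n\ge 4$. Then $$\mathrm{vol}(\Lambda(G))=\frac{n^2+4n}{8}.$$
   Context: A matrix $G\in\mathbb{F}_q^{k\times n}$ is systematic if its first $k$ columns form the $k\times k$ identity matrix. It is an MDS matrix if it has rank $k$ and its row space $\mathcal{C}$ has minimum Hamming distance $d$ (the minimum number of nonzero entries of a nonzero vector of $\mathcal{C}$) satisfying $k+d-1=n$; equivalently, every $k$ columns of $G$ are linearly independent over $\mathbb{F}_q$. Here $k=2$. Let $G^\nu$ denote the $\nu$-th column of $G$ and $e_i$ the $i$-th standard basis vector of $\mathbb{F}_q^k$. For $i\in\{1,\ldots,k\}$ let $\mathcal{R}_i^{\mathrm{all}}(G)=\{R\subseteq\{1,\ldots,n\}\mid e_i\in\langle G^\nu\mid\nu\in R\rangle\}$, where $\langle\cdot\rangle$ is the $\mathbb{F}_q$-span. The service rate region $\Lambda(G)\subseteq\mathbb{R}^k$ (with server capacity $1$) is the set of all $(\lambda_1,\ldots,\lambda_k)\in\mathbb{R}^k$ for which there exist real numbers $\lambda_{i,R}\ge 0$ ($i\in\{1,\ldots,k\}$, $R\in\mathcal{R}_i^{\mathrm{all}}(G)$) with $\sum_{R\in\mathcal{R}_i^{\mathrm{all}}(G)}\lambda_{i,R}=\lambda_i$ for all $i$, and $\sum_{i=1}^k\sum_{R\in\mathcal{R}_i^{\mathrm{all}}(G),\,\nu\in R}\lambda_{i,R}\le 1$ for all $\nu\in\{1,\ldots,n\}$.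 It is a convex polytope; $\mathrm{vol}$ denotes the Lebesgue measure (in $\mathbb{R}^k$) of its interior. *)

theory Defs
  imports "HOL-Analysis.Analysis"
begin

text \<open>
  A \<open>k \<times> n\<close> matrix over a field is an element of \<open>'a ^ 'n ^ 'k\<close>, where the row and column index
  types are finite; finite linear orders on them say which rows and columns come first. A finite
  field of order \<open>q\<close> is a type of class \<open>field\<close> and \<open>finite\<close> with \<open>q\<close> elements.
\<close>

text \<open>
  The strictly increasing map \<open>\<sigma>\<close> onto an initial segment of the column indices is unique: it sends
  the i-th row index to the i-th column index.
\<close>

definition systematic :: "'a::field ^ 'n::{finite,linorder} ^ 'k::{finite,linorder} \<Rightarrow> bool" where
  "systematic G \<longleftrightarrow>
     (\<exists>\<sigma> :: 'k \<Rightarrow> 'n. strict_mono \<sigma> \<and> (\<forall>i. \<forall>\<nu> \<le> \<sigma> i. \<nu> \<in> range \<sigma>) \<and>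
        (\<chi> i j. G $ i $ \<sigma> j) = mat 1)"

definition row_space :: "'a::field ^ 'n ^ 'k \<Rightarrow> ('a ^ 'n) set" where
  "row_space G = vec.span (rows G)"

definition hamming_weight :: "'a::zero ^ 'n \<Rightarrow> nat" where
  "hamming_weight v = card {\<nu>. v $ \<nu> \<noteq> 0}"

text \<open>Meaningful only if \<open>C\<close> contains a nonzero vector.\<close>

definition min_distance :: "('a::zero ^ 'n) set \<Rightarrow> nat" where
  "min_distance C = Min (hamming_weight ` (C - {0}))"

definition MDS_matrix :: "'a::field ^ 'n ^ 'k \<Rightarrow> bool" where
  "MDS_matrix G \<longleftrightarrow>
     rank G = CARD('k) \<and> CARD('k) + min_distance (row_space G) - 1 = CARD('n)"

definition recovery_sets :: "'a::field ^ 'n ^ 'k \<Rightarrow> 'k \<Rightarrow> 'n set set" where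
  "recovery_sets G i = {R. axis i 1 \<in> vec.span ((\<lambda>\<nu>. column \<nu> G) ` R)}"

text \<open>The values \<open>f i R\<close> with \<open>R\<close> not a recovery set for \<open>i\<close> play no role.\<close>

definition service_rate_region :: "'a::field ^ 'n ^ 'k \<Rightarrow> (real ^ 'k) set" where
  "service_rate_region G =
     {l. \<exists>f :: 'k \<Rightarrow> 'n set \<Rightarrow> real.
           (\<forall>i. \<forall>R \<in> recovery_sets G i. f i R \<ge> 0) \<and>
           (\<forall>i. (\<Sum>R \<in> recovery_sets G i. f i R) = l $ i) \<and>
           (\<forall>\<nu>. (\<Sum>i\<in>UNIV. \<Sum>R \<in> {R \<in> recovery_sets G i. \<nu> \<in> R}. f i R) \<le> 1)}"

definition vol :: "(real ^ 'k) set \<Rightarrow> real" where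
  "vol S = measure lebesgue (interior S)"

end

theory Submission
  imports Defs
begin

text \<open>
  In a \<open>2 \<times> n\<close> MDS matrix any two columns are linearly independent. Hence a set of servers recovers
  the \<open>i\<close>-th basis vector if and only if it contains the systematic column for \<open>i\<close> or has at least
  two elements (\<open>recovery_sets_systematic_MDS\<close>). A unit of rate therefore costs one unit of server
  capacity if it is served by the systematic server alone, and at least two units otherwise. As the
  systematic server for \<open>i\<close> can serve at most \<open>min 1 l\<^sub>i\<close> alone and the total capacity is \<open>n\<close>, every
  achievable rate pair satisfies
  \<open>2 l\<^sub>1 + 2 l\<^sub>2 \<le> n + min 1 l\<^sub>1 + min 1 l\<^sub>2\<close> (\<open>service_rate_bounds\<close>).

  Spelled out, this inequality describes the polygon with the vertices \<open>(0, 0)\<close>, \<open>((n + 1) / 2, 0)\<close>,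
  \<open>(n / 2, 1)\<close>, \<open>(1, n / 2)\<close>, \<open>(0, (n + 1) / 2)\<close>. The nonzero vertices are achieved by using
  systematic servers alone up to capacity, and by spreading the remaining requests for one of the
  two symbols evenly over all pairs of the other servers, which exhausts these (\<open>achievable_vertex\<close>).
  Since the service rate region is convex and closed under lowering the rates, it is the whole
  polygon (\<open>service_rate_region_eq_rate_polygon\<close>). The polygon is a right triangle with legs
  \<open>(n + 2) / 2\<close> without two corner triangles of area \<open>1 / 4\<close> each, so that its area is
  \<open>(n + 2)\<^sup>2 / 8 - 1 / 2 = (n\<^sup>2 + 4 n) / 8\<close> (\<open>measure_rate_polygon\<close>).
\<close>

section \<open>Recovery sets of a systematic MDS matrix with two rows\<close>

definition minor2 :: "'a::comm_ring_1 ^ 'n ^ 2 \<Rightarrow> 'n \<Rightarrow> 'n \<Rightarrow> 'a" where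
  "minor2 G \<mu> \<nu> = G $ 1 $ \<mu> * G $ 2 $ \<nu> - G $ 1 $ \<nu> * G $ 2 $ \<mu>"

lemma row_combination_in_row_space:
  fixes G :: "'a::field ^ 'n ^ 2"
  shows "(\<chi> \<nu>. \<alpha> * G $ 1 $ \<nu> + \<beta> * G $ 2 $ \<nu>) \<in> row_space G"
proof -
  have "(\<chi> \<nu>. \<alpha> * G $ 1 $ \<nu> + \<beta> * G $ 2 $ \<nu>) = \<alpha> *s row 1 G + \<beta> *s row 2 G"
    by (simp add: vec_eq_iff row_def)
  moreover have "row i G \<in> vec.span (rows G)" for i
    by (rule vec.span_base) (auto simp: rows_def)
  ultimately show ?thesis
    by (simp add: row_space_def vec.span_add vec.span_scale)
qed

text \<open>
  Two proportional columns impose only one linear condition on the coefficients of a combination of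
  two rows.
\<close>

lemma minor2_eq_0_imp_row_combination_vanishes:
  fixes G :: "'a::field ^ 'n ^ 2"
  assumes "minor2 G \<mu> \<nu> = 0"
  obtains \<alpha> \<beta> where "(\<alpha>, \<beta>) \<noteq> (0, 0)"
    and "\<alpha> * G $ 1 $ \<mu> + \<beta> * G $ 2 $ \<mu> = 0" and "\<alpha> * G $ 1 $ \<nu> + \<beta> * G $ 2 $ \<nu> = 0"
proof -
  consider "G $ 1 $ \<mu> \<noteq> 0 \<or> G $ 2 $ \<mu> \<noteq> 0" | "G $ 1 $ \<nu> \<noteq> 0 \<or> G $ 2 $ \<nu> \<noteq> 0"
    | "G $ 1 $ \<mu> = 0" "G $ 2 $ \<mu> = 0" "G $ 1 $ \<nu> = 0" "G $ 2 $ \<nu> = 0"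
    by blast
  then show ?thesis
  proof cases
    case 1
    then show ?thesis
      using assms by (intro that[of "G $ 2 $ \<mu>" "- G $ 1 $ \<mu>"]) (auto simp: minor2_def algebra_simps)
  next
    case 2
    then show ?thesis
      using assms by (intro that[of "G $ 2 $ \<nu>" "- G $ 1 $ \<nu>"]) (auto simp: minor2_def algebra_simps)
  next
    case 3
    then show ?thesis
      by (intro that[of 1 0]) auto
  qed
qed

text \<open>
  If the minor vanished, some combination of the rows would vanish at both positions. It is a nonzero
  vector because its coefficients reappear at the systematic positions, so it would be a codeword of
  weight at most \<open>n - 2\<close>, whereas the minimum distance is \<open>n - 1\<close>.
\<close>

lemma MDS_imp_minor2_nonzero:
  fixes G :: "'a::{field,finite} ^ 'n::finite ^ 2"
  assumes mds: "MDS_matrix G" and sys: "\<And>i j. G $ i $ \<sigma> j = (if i = j then 1 else 0)"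
    and "\<mu> \<noteq> \<nu>"
  shows "minor2 G \<mu> \<nu> \<noteq> 0"
proof
  assume "minor2 G \<mu> \<nu> = 0"
  then obtain \<alpha> \<beta> where nz: "(\<alpha>, \<beta>) \<noteq> (0, 0)"
    and van: "\<alpha> * G $ 1 $ \<mu> + \<beta> * G $ 2 $ \<mu> = 0" "\<alpha> * G $ 1 $ \<nu> + \<beta> * G $ 2 $ \<nu> = 0"
    by (rule minor2_eq_0_imp_row_combination_vanishes)
  define v :: "'a ^ 'n" where "v = (\<chi> \<nu>. \<alpha> * G $ 1 $ \<nu> + \<beta> * G $ 2 $ \<nu>)"
  have "v $ \<sigma> 1 = \<alpha>" "v $ \<sigma> 2 = \<beta>"
    by (simp_all add: v_def sys)
  then have "v \<noteq> 0"
    using nz by auto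
  then have "v \<in> row_space G - {0}"
    using row_combination_in_row_space[of \<alpha> G \<beta>] by (simp add: v_def)
  then have "min_distance (row_space G) \<le> hamming_weight v"
    unfolding min_distance_def by (intro Min_le) auto
  also have "\<dots> \<le> card (UNIV - {\<mu>, \<nu>})"
    unfolding hamming_weight_def using van by (intro card_mono) (auto simp: v_def)
  also have "\<dots> = CARD('n) - 2"
    using \<open>\<mu> \<noteq> \<nu>\<close> by (subst card_Diff_subset) auto
  finally have "min_distance (row_space G) \<le> CARD('n) - 2" .
  moreover have "card {\<mu>, \<nu>} \<le> CARD('n)"
    by (rule card_mono) auto
  ultimately show False
    using mds \<open>\<mu> \<noteq> \<nu>\<close> by (auto simp: MDS_matrix_def)
qed

lemma axis_in_span_two_columns:
  fixes G :: "'a::field ^ 'n ^ 2"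
  assumes "minor2 G \<mu> \<nu> \<noteq> 0"
  shows "axis i 1 \<in> vec.span {column \<mu> G, column \<nu> G}"
proof -
  let ?d = "minor2 G \<mu> \<nu>"
  \<comment> \<open>These are the coefficients given by Cramer's rule.\<close>
  define x y where "x = (if i = 1 then G $ 2 $ \<nu> else - G $ 1 $ \<nu>) / ?d"
    and "y = (if i = 1 then - G $ 2 $ \<mu> else G $ 1 $ \<mu>) / ?d"
  have "axis i 1 $ k = (x *s column \<mu> G + y *s column \<nu> G) $ k" for k
    using exhaust_2[of i] exhaust_2[of k] assms
    by (auto simp: x_def y_def column_def axis_def divide_simps) (simp_all add: minor2_def algebra_simps)
  then have "axis i 1 = x *s column \<mu> G + y *s column \<nu> G"
    by (simp add: vec_eq_iff)
  also have "\<dots> \<in> vec.span {column \<mu> G, column \<nu> G}"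
    by (intro vec.span_add vec.span_scale vec.span_base) auto
  finally show ?thesis .
qed

lemma recovery_sets_systematic_MDS:
  fixes G :: "'a::field ^ 'n::finite ^ 2"
  assumes sys: "\<And>i j. G $ i $ \<sigma> j = (if i = j then 1 else 0)"
    and minors: "\<And>\<mu> \<nu>. \<mu> \<noteq> \<nu> \<Longrightarrow> minor2 G \<mu> \<nu> \<noteq> 0"
  shows "recovery_sets G i = {R. \<sigma> i \<in> R \<or> 2 \<le> card R}"
proof (intro set_eqI iffI)
  fix R assume "R \<in> {R. \<sigma> i \<in> R \<or> 2 \<le> card R}"
  then consider "\<sigma> i \<in> R" | "2 \<le> card R"
    by blast
  then show "R \<in> recovery_sets G i"
  proof cases
    case 1
    have "axis i 1 = column (\<sigma> i) G"
      by (auto simp: vec_eq_iff column_def sys axis_def)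
    then show ?thesis
      using 1 by (auto simp: recovery_sets_def intro!: vec.span_base)
  next
    case 2
    then obtain \<mu> \<nu> where "\<mu> \<in> R" "\<nu> \<in> R" "\<mu> \<noteq> \<nu>"
      by (metis card_2_iff' ex_card subset_eq)
    then have "axis i 1 \<in> vec.span {column \<mu> G, column \<nu> G}"
      using minors axis_in_span_two_columns by blast
    moreover have "{column \<mu> G, column \<nu> G} \<subseteq> (\<lambda>\<nu>. column \<nu> G) ` R"
      using \<open>\<mu> \<in> R\<close> \<open>\<nu> \<in> R\<close> by auto
    ultimately show ?thesis
      unfolding recovery_sets_def using vec.span_mono by blast
  qed
next
  fix R assume R: "R \<in> recovery_sets G i"
  show "R \<in> {R. \<sigma> i \<in> R \<or> 2 \<le> card R}"
  proof (rule ccontr)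
    assume "\<not> ?thesis"
    then have "\<sigma> i \<notin> R" "card R < 2"
      by auto
    then consider "R = {}" | \<nu> where "R = {\<nu>}"
      by (metis One_nat_def card_0_eq card_1_singletonE finite less_2_cases)
    then show False
    proof cases
      case 1
      then show False
        using R by (simp add: recovery_sets_def)
    next
      case (2 \<nu>)
      then obtain k where "axis i 1 = k *s column \<nu> G"
        using R by (auto simp: recovery_sets_def vec.span_singleton)
      then have ax: "axis i 1 $ j = k * G $ j $ \<nu>" for j
        by (simp add: column_def)
      have "k * minor2 G (\<sigma> i) \<nu> = 0"
        using ax[of 1] ax[of 2] exhaust_2[of i]
        by (auto simp: minor2_def sys axis_def algebra_simps)
      moreover have "k \<noteq> 0"
        using ax[of i] by (auto simp: axis_def)
      ultimately have "minor2 G (\<sigma> i) \<nu> = 0"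
        by simp
      then show False
        using minors[of "\<sigma> i" \<nu>] \<open>\<sigma> i \<notin> R\<close> 2 by auto
    qed
  qed
qed

section \<open>General properties of service rate regions\<close>

lemma service_rate_regionI:
  fixes G :: "'a::field ^ 'n::finite ^ 'k::finite"
  assumes "\<And>i R. R \<in> recovery_sets G i \<Longrightarrow> f i R \<ge> 0"
    and "\<And>i. (\<Sum>R\<in>recovery_sets G i. f i R) = l $ i"
    and "\<And>\<nu>. (\<Sum>i\<in>UNIV. \<Sum>R\<in>{R \<in> recovery_sets G i. \<nu> \<in> R}. f i R) \<le> 1"
  shows "l \<in> service_rate_region G"
  unfolding service_rate_region_def using assms by blast

lemma service_rate_regionE:
  fixes G :: "'a::field ^ 'n::finite ^ 'k::finite"
  assumes "l \<in> service_rate_region G"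
  obtains f where "\<And>i R. R \<in> recovery_sets G i \<Longrightarrow> f i R \<ge> 0"
    and "\<And>i. (\<Sum>R\<in>recovery_sets G i. f i R) = l $ i"
    and "\<And>\<nu>. (\<Sum>i\<in>UNIV. \<Sum>R\<in>{R \<in> recovery_sets G i. \<nu> \<in> R}. f i R) \<le> 1"
  using assms unfolding service_rate_region_def by blast

lemma convex_service_rate_region:
  fixes G :: "'a::field ^ 'n::finite ^ 'k::finite"
  shows "convex (service_rate_region G)"
proof (rule convexI)
  fix x y :: "real ^ 'k" and u v :: real
  assume x: "x \<in> service_rate_region G" and y: "y \<in> service_rate_region G"
    and uv: "0 \<le> u" "0 \<le> v" "u + v = 1"
  obtain f where f: "\<And>i R. R \<in> recovery_sets G i \<Longrightarrow> f i R \<ge> 0"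
    "\<And>i. (\<Sum>R\<in>recovery_sets G i. f i R) = x $ i"
    "\<And>\<nu>. (\<Sum>i\<in>UNIV. \<Sum>R\<in>{R \<in> recovery_sets G i. \<nu> \<in> R}. f i R) \<le> 1"
    using service_rate_regionE[OF x] by blast
  obtain g where g: "\<And>i R. R \<in> recovery_sets G i \<Longrightarrow> g i R \<ge> 0"
    "\<And>i. (\<Sum>R\<in>recovery_sets G i. g i R) = y $ i"
    "\<And>\<nu>. (\<Sum>i\<in>UNIV. \<Sum>R\<in>{R \<in> recovery_sets G i. \<nu> \<in> R}. g i R) \<le> 1"
    using service_rate_regionE[OF y] by blast
  show "u *\<^sub>R x + v *\<^sub>R y \<in> service_rate_region G"
  proof (rule service_rate_regionI[where f = "\<lambda>i R. u * f i R + v * g i R"])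
    show "0 \<le> u * f i R + v * g i R" if "R \<in> recovery_sets G i" for i R
      using f(1) g(1) that uv by simp
    show "(\<Sum>R\<in>recovery_sets G i. u * f i R + v * g i R) = (u *\<^sub>R x + v *\<^sub>R y) $ i" for i
      by (simp add: sum.distrib f(2) g(2) flip: sum_distrib_left)
    fix \<nu>
    have "(\<Sum>i\<in>UNIV. \<Sum>R\<in>{R \<in> recovery_sets G i. \<nu> \<in> R}. u * f i R + v * g i R)
        = u * (\<Sum>i\<in>UNIV. \<Sum>R\<in>{R \<in> recovery_sets G i. \<nu> \<in> R}. f i R)
          + v * (\<Sum>i\<in>UNIV. \<Sum>R\<in>{R \<in> recovery_sets G i. \<nu> \<in> R}. g i R)"
      by (simp add: sum.distrib flip: sum_distrib_left)
    also have "\<dots> \<le> u * 1 + v * 1"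
      using f(3) g(3) uv by (intro add_mono mult_left_mono) auto
    finally show "(\<Sum>i\<in>UNIV. \<Sum>R\<in>{R \<in> recovery_sets G i. \<nu> \<in> R}. u * f i R + v * g i R) \<le> 1"
      using uv by simp
  qed
qed

text \<open>
  Lowering the rate of a symbol scales all its shares by the same factor, which only lowers the loads.
\<close>

lemma service_rate_region_down_closed:
  fixes G :: "'a::field ^ 'n::finite ^ 'k::finite"
  assumes "l \<in> service_rate_region G" and m: "\<And>i. 0 \<le> m $ i" "\<And>i. m $ i \<le> l $ i"
  shows "m \<in> service_rate_region G"
proof -
  obtain f where f: "\<And>i R. R \<in> recovery_sets G i \<Longrightarrow> f i R \<ge> 0"
    "\<And>i. (\<Sum>R\<in>recovery_sets G i. f i R) = l $ i"
    "\<And>\<nu>. (\<Sum>i\<in>UNIV. \<Sum>R\<in>{R \<in> recovery_sets G i. \<nu> \<in> R}. f i R) \<le> 1"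
    using service_rate_regionE[OF assms(1)] by blast
  \<comment> \<open>If \<open>l $ i = 0\<close>, then \<open>m $ i = 0\<close> as well and the quotient below is the right factor \<open>0\<close>.\<close>
  define c where "c i = m $ i / l $ i" for i
  have c: "0 \<le> c i" "c i \<le> 1" "c i * l $ i = m $ i" for i
    using m[of i] by (auto simp: c_def divide_le_eq)
  show ?thesis
  proof (rule service_rate_regionI[where f = "\<lambda>i R. c i * f i R"])
    show "0 \<le> c i * f i R" if "R \<in> recovery_sets G i" for i R
      using that c f(1) by simp
    show "(\<Sum>R\<in>recovery_sets G i. c i * f i R) = m $ i" for i
      by (simp add: f(2) c flip: sum_distrib_left)
    fix \<nu>
    have "(\<Sum>i\<in>UNIV. \<Sum>R\<in>{R \<in> recovery_sets G i. \<nu> \<in> R}. c i * f i R)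
        \<le> (\<Sum>i\<in>UNIV. \<Sum>R\<in>{R \<in> recovery_sets G i. \<nu> \<in> R}. f i R)"
      using c f(1) by (intro sum_mono mult_left_le_one_le) auto
    then show "(\<Sum>i\<in>UNIV. \<Sum>R\<in>{R \<in> recovery_sets G i. \<nu> \<in> R}. c i * f i R) \<le> 1"
      using f(3)[of \<nu>] by simp
  qed
qed

section \<open>Upper bounds on the service rates\<close>

text \<open>
  Double counting: summed over all servers, the load is the sum of \<open>card R * f i R\<close> and is at most
  the number of servers. The systematic singleton is the only recovery set of size one; its share of
  the rate is bounded by its capacity and by the whole rate.
\<close>

lemma service_rate_bounds:
  fixes G :: "'a::field ^ 'n::finite ^ 2" and \<sigma> :: "2 \<Rightarrow> 'n"
  assumes rec: "\<And>i. recovery_sets G i = {R. \<sigma> i \<in> R \<or> 2 \<le> card R}"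
    and "l \<in> service_rate_region G"
  shows "0 \<le> l $ i"
    and "2 * l $ 1 + 2 * l $ 2 \<le> CARD('n) + min 1 (l $ 1) + min 1 (l $ 2)"
proof -
  obtain f where f: "\<And>i R. R \<in> recovery_sets G i \<Longrightarrow> f i R \<ge> 0"
    "\<And>i. (\<Sum>R\<in>recovery_sets G i. f i R) = l $ i"
    "\<And>\<nu>. (\<Sum>i\<in>UNIV. \<Sum>R\<in>{R \<in> recovery_sets G i. \<nu> \<in> R}. f i R) \<le> 1"
    using service_rate_regionE[OF assms(2)] by blast
  show "0 \<le> l $ i"
    using f(1) sum_nonneg[of "recovery_sets G i" "f i"] f(2)[of i] by auto
  have single_rec: "{\<sigma> i} \<in> recovery_sets G i" for i
    by (simp add: rec)
  have single: "f i {\<sigma> i} \<le> min 1 (l $ i)" for i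
  proof -
    have "f i {\<sigma> i} \<le> (\<Sum>R\<in>recovery_sets G i. f i R)"
      using single_rec f(1) by (intro member_le_sum) auto
    moreover have "f i {\<sigma> i} \<le> (\<Sum>R\<in>{R \<in> recovery_sets G i. \<sigma> i \<in> R}. f i R)"
      using single_rec f(1) by (intro member_le_sum) auto
    moreover have "\<dots> \<le> (\<Sum>i'\<in>UNIV. \<Sum>R\<in>{R \<in> recovery_sets G i'. \<sigma> i \<in> R}. f i' R)"
      using f(1) by (intro member_le_sum[where f = "\<lambda>i'. \<Sum>R\<in>{R \<in> recovery_sets G i'. \<sigma> i \<in> R}. f i' R"] sum_nonneg) auto
    ultimately show ?thesis
      using f(2)[of i] f(3)[of "\<sigma> i"] by simp
  qed
  have load: "2 * l $ i - f i {\<sigma> i} \<le> (\<Sum>R\<in>recovery_sets G i. real (card R) * f i R)" for i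
  proof -
    have size: "2 - (if R = {\<sigma> i} then 1 else 0) \<le> real (card R)" if "R \<in> recovery_sets G i" for R
    proof -
      have "card R \<noteq> 0"
        using that by (auto simp: rec)
      moreover have "card R \<noteq> 1" if "R \<noteq> {\<sigma> i}"
        using that \<open>R \<in> recovery_sets G i\<close> by (auto simp: rec card_1_singleton_iff)
      ultimately have "R = {\<sigma> i} \<or> 2 \<le> card R"
        by linarith
      then show ?thesis
        by (elim disjE) auto
    qed
    have "2 * l $ i - f i {\<sigma> i}
        = (\<Sum>R\<in>recovery_sets G i. 2 * f i R) - (\<Sum>R\<in>recovery_sets G i. if R = {\<sigma> i} then f i R else 0)"
      using single_rec by (simp add: f(2) flip: sum_distrib_left)
    also have "\<dots> = (\<Sum>R\<in>recovery_sets G i. (2 - (if R = {\<sigma> i} then 1 else 0)) * f i R)"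
      unfolding sum_subtractf[symmetric] by (intro sum.cong) (auto simp: algebra_simps)
    also have "\<dots> \<le> (\<Sum>R\<in>recovery_sets G i. real (card R) * f i R)"
      using size f(1) by (intro sum_mono mult_right_mono) auto
    finally show ?thesis .
  qed
  have "(\<Sum>R\<in>recovery_sets G i. real (card R) * f i R)
      = (\<Sum>\<nu>\<in>UNIV. \<Sum>R\<in>{R \<in> recovery_sets G i. \<nu> \<in> R}. f i R)" for i
    by (subst sum.swap_restrict) auto
  then have "(\<Sum>i\<in>UNIV. \<Sum>R\<in>recovery_sets G i. real (card R) * f i R)
      = (\<Sum>\<nu>\<in>UNIV. \<Sum>i\<in>UNIV. \<Sum>R\<in>{R \<in> recovery_sets G i. \<nu> \<in> R}. f i R)"
    by (subst sum.swap) simp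
  also have "\<dots> \<le> (\<Sum>\<nu>\<in>(UNIV :: 'n set). 1)"
    using f(3) by (intro sum_mono)
  finally have "(\<Sum>i\<in>UNIV. \<Sum>R\<in>recovery_sets G i. real (card R) * f i R) \<le> CARD('n)"
    by simp
  then show "2 * l $ 1 + 2 * l $ 2 \<le> CARD('n) + min 1 (l $ 1) + min 1 (l $ 2)"
    using load[of 1] load[of 2] single[of 1] single[of 2] unfolding sum_2 by linarith
qed

section \<open>Achievable service rates\<close>

lemma two_index_cases:
  fixes i j m :: 2
  assumes "i \<noteq> j"
  shows "m = i \<or> m = j"
  using assms exhaust_2[of i] exhaust_2[of j] exhaust_2[of m] by auto

lemma ex_other_index_2: "\<exists>j :: 2. i \<noteq> j"
  by (rule exI[of _ "i + 1"]) simp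

text \<open>
  The weight is chosen such that every element of \<open>S\<close>, which lies in \<open>card S - 1\<close> pairs, carries load
  exactly \<open>1\<close>.
\<close>

definition pair_weight :: "'n set \<Rightarrow> 'n set \<Rightarrow> real" where
  "pair_weight S R = (if R \<subseteq> S \<and> card R = 2 then 1 / (real (card S) - 1) else 0)"

lemma pair_weight_nonneg:
  assumes "1 \<le> card S"
  shows "0 \<le> pair_weight S R"
  using assms by (simp add: pair_weight_def)

lemma sum_pair_weight:
  fixes S :: "'n::finite set"
  assumes "2 \<le> card S" and \<R>: "{R. 2 \<le> card R} \<subseteq> \<R>"
  shows "(\<Sum>R\<in>\<R>. pair_weight S R) = real (card S) / 2"
proof -
  have "(\<Sum>R\<in>\<R>. pair_weight S R) = (\<Sum>R\<in>{R. R \<subseteq> S \<and> card R = 2}. 1 / (real (card S) - 1))"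
    using \<R> by (intro sum.mono_neutral_cong_right) (auto simp: pair_weight_def)
  also have "\<dots> = real (card S choose 2) / (real (card S) - 1)"
    by (simp add: n_subsets)
  also have "real (card S choose 2) = real (card S) * (real (card S) - 1) / 2"
  proof -
    have "2 dvd card S * (card S - 1)"
      by (cases "card S") auto
    then show ?thesis
      using assms(1) by (simp add: choose_two real_of_nat_div of_nat_diff)
  qed
  also have "\<dots> / (real (card S) - 1) = real (card S) / 2"
    using assms(1) by (simp add: field_simps)
  finally show ?thesis .
qed

lemma card_pairs_containing:
  assumes "finite S" and "\<nu> \<in> S"
  shows "card {R. R \<subseteq> S \<and> card R = 2 \<and> \<nu> \<in> R} = card S - 1"
proof -
  have "{R. R \<subseteq> S \<and> card R = 2 \<and> \<nu> \<in> R} = (\<lambda>\<mu>. {\<mu>, \<nu>}) ` (S - {\<nu>})"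
    using assms by (fastforce simp: card_2_iff)
  moreover have "inj_on (\<lambda>\<mu>. {\<mu>, \<nu>}) (S - {\<nu>})"
    by (auto simp: inj_on_def doubleton_eq_iff)
  ultimately show ?thesis
    using assms by (simp add: card_image)
qed

lemma pair_weight_load:
  fixes S :: "'n::finite set"
  assumes "2 \<le> card S" and \<R>: "{R. 2 \<le> card R} \<subseteq> \<R>"
  shows "(\<Sum>R\<in>{R \<in> \<R>. \<nu> \<in> R}. pair_weight S R) = (if \<nu> \<in> S then 1 else 0)"
proof -
  have "(\<Sum>R\<in>{R \<in> \<R>. \<nu> \<in> R}. pair_weight S R)
      = (\<Sum>R\<in>{R. R \<subseteq> S \<and> card R = 2 \<and> \<nu> \<in> R}. 1 / (real (card S) - 1))"
    using \<R> by (intro sum.mono_neutral_cong_right) (auto simp: pair_weight_def)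
  also have "\<dots> = real (card {R. R \<subseteq> S \<and> card R = 2 \<and> \<nu> \<in> R}) / (real (card S) - 1)"
    by simp
  also have "\<dots> = (if \<nu> \<in> S then 1 else 0)"
  proof (cases "\<nu> \<in> S")
    case True
    then show ?thesis
      using assms(1) by (simp add: card_pairs_containing of_nat_diff)
  next
    case False
    then have "{R. R \<subseteq> S \<and> card R = 2 \<and> \<nu> \<in> R} = {}"
      by auto
    then show ?thesis
      using False by (metis card.empty div_0 of_nat_0)
  qed
  finally show ?thesis .
qed

text \<open>
  Symbol \<open>i\<close> is served by its systematic server and by pairs of servers in \<open>S\<close>; symbol \<open>j\<close> is
  served, if at all, by its systematic server alone. If \<open>S\<close> is the set of all servers that are not
  used alone, \<open>b = 0\<close> gives the vertex of the region on the \<open>i\<close>-th axis, where the systematic server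
  of \<open>j\<close> takes part in the pairs, and \<open>b = 1\<close> gives the vertex next to it.
\<close>

lemma achievable_vertex:
  fixes G :: "'a::field ^ 'n::finite ^ 2" and \<sigma> :: "2 \<Rightarrow> 'n"
  assumes rec: "\<And>i. recovery_sets G i = {R. \<sigma> i \<in> R \<or> 2 \<le> card R}"
    and "inj \<sigma>" and "i \<noteq> j" and S: "2 \<le> card S" "\<sigma> i \<notin> S"
    and a: "a = 1 + real (card S) / 2" and b: "b = 0 \<or> b = 1 \<and> \<sigma> j \<notin> S"
  shows "(\<chi> m. if m = i then a else b) \<in> service_rate_region G"
proof (rule service_rate_regionI[where f = "\<lambda>m R. if m = i
    then pair_weight S R + (if R = {\<sigma> i} then 1 else 0) else if R = {\<sigma> j} then b else 0"])
  have ge2: "{R. 2 \<le> card R} \<subseteq> recovery_sets G m" for m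
    by (auto simp: rec)
  have single: "{\<sigma> m} \<in> recovery_sets G m" for m
    by (simp add: rec)
  have UNIV_ij: "UNIV = {i, j}" and other: "m \<noteq> i \<longleftrightarrow> m = j" for m
    using two_index_cases[OF \<open>i \<noteq> j\<close>] \<open>i \<noteq> j\<close> by auto
  have "\<sigma> i \<noteq> \<sigma> j"
    using \<open>inj \<sigma>\<close> \<open>i \<noteq> j\<close> by (auto dest: injD)
  show "0 \<le> (if m = i then pair_weight S R + (if R = {\<sigma> i} then 1 else 0)
      else if R = {\<sigma> j} then b else 0)" for m R
    using pair_weight_nonneg[of S R] S b by auto
  show "(\<Sum>R\<in>recovery_sets G m. if m = i then pair_weight S R + (if R = {\<sigma> i} then 1 else 0)
      else if R = {\<sigma> j} then b else 0)
      = (\<chi> m. if m = i then a else b) $ m" for m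
    using single sum_pair_weight[OF S(1) ge2, of m] other[of m]
    by (cases "m = i") (auto simp: sum.distrib a)
  fix \<nu>
  have "(\<Sum>R\<in>{R \<in> recovery_sets G i. \<nu> \<in> R}. pair_weight S R + (if R = {\<sigma> i} then 1 else 0))
      = (if \<nu> \<in> S then 1 else 0) + (if \<nu> = \<sigma> i then 1 else 0)"
    using single[of i] pair_weight_load[OF S(1) ge2, of i \<nu>] by (simp add: sum.distrib)
  moreover have "(\<Sum>R\<in>{R \<in> recovery_sets G j. \<nu> \<in> R}. if R = {\<sigma> j} then b else 0)
      = (if \<nu> = \<sigma> j then b else 0)"
    using single[of j] by simp
  ultimately show "(\<Sum>m\<in>UNIV. \<Sum>R\<in>{R \<in> recovery_sets G m. \<nu> \<in> R}.
      if m = i then pair_weight S R + (if R = {\<sigma> i} then 1 else 0)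
      else if R = {\<sigma> j} then b else 0) \<le> 1"
    using \<open>i \<noteq> j\<close> \<open>\<sigma> i \<noteq> \<sigma> j\<close> S b by (simp add: UNIV_ij) auto
qed

section \<open>The service rate region as a polygon\<close>

text \<open>
  For nonnegative rates the last three inequalities say
  \<open>2 l\<^sub>1 + 2 l\<^sub>2 \<le> n + min 1 l\<^sub>1 + min 1 l\<^sub>2\<close> if \<open>n \<ge> 2\<close>: when both minima equal the rates, the
  inequality \<open>l\<^sub>1 + l\<^sub>2 \<le> n\<close> is automatic.
\<close>

definition rate_polygon :: "real \<Rightarrow> (real ^ 2) set" where
  "rate_polygon n = {l. 0 \<le> l $ 1 \<and> 0 \<le> l $ 2 \<and> 2 * l $ 1 + 2 * l $ 2 \<le> n + 2
     \<and> 2 * l $ 1 + l $ 2 \<le> n + 1 \<and> l $ 1 + 2 * l $ 2 \<le> n + 1}"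

text \<open>
  Every point of the polygon lies below a point on the segment joining two neighbouring vertices,
  which is achievable by convexity. If \<open>l $ j \<le> 1\<close>, that segment runs from the vertex on the \<open>i\<close>-th
  axis to the corner \<open>l $ i = n / 2, l $ j = 1\<close>; if both rates exceed \<open>1\<close>, it joins the two corners.
\<close>

lemma service_rate_region_eq_rate_polygon:
  fixes G :: "'a::field ^ 'n::finite ^ 2" and \<sigma> :: "2 \<Rightarrow> 'n"
  assumes rec: "\<And>i. recovery_sets G i = {R. \<sigma> i \<in> R \<or> 2 \<le> card R}"
    and "inj \<sigma>" and n: "4 \<le> CARD('n)"
  shows "service_rate_region G = rate_polygon (real CARD('n))"
proof (intro equalityI subsetI)
  fix l assume "l \<in> service_rate_region G"
  note b = service_rate_bounds[OF rec this]
  show "l \<in> rate_polygon (real CARD('n))"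
    using b(1)[of 1] b(1)[of 2] b(2) by (auto simp: rate_polygon_def)
next
  fix l assume l: "l \<in> rate_polygon (real CARD('n))"
  define n where "n = real CARD('n)"
  have n4: "4 \<le> n"
    using n by (simp add: n_def)
  have corner: "(\<chi> m. if m = i then n / 2 else 1) \<in> service_rate_region G" for i
  proof -
    obtain j where "i \<noteq> j"
      using ex_other_index_2 by blast
    then have "\<sigma> i \<noteq> \<sigma> j"
      using \<open>inj \<sigma>\<close> by (auto dest: injD)
    then have card: "card (- {\<sigma> i, \<sigma> j}) = CARD('n) - 2"
      by (simp add: Compl_eq_Diff_UNIV card_Diff_subset)
    then have "n / 2 = 1 + real (card (- {\<sigma> i, \<sigma> j})) / 2"
      using n by (simp add: n_def of_nat_diff field_simps)
    moreover have "2 \<le> card (- {\<sigma> i, \<sigma> j})"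
      using n card by simp
    ultimately show ?thesis
      by (intro achievable_vertex[OF rec \<open>inj \<sigma>\<close> \<open>i \<noteq> j\<close>, where S = "- {\<sigma> i, \<sigma> j}"]) auto
  qed
  have axis_vertex: "(\<chi> m. if m = i then (n + 1) / 2 else 0) \<in> service_rate_region G" for i
  proof -
    obtain j where "i \<noteq> j"
      using ex_other_index_2 by blast
    have card: "card (- {\<sigma> i}) = CARD('n) - 1"
      by (simp add: Compl_eq_Diff_UNIV card_Diff_subset)
    then have "(n + 1) / 2 = 1 + real (card (- {\<sigma> i})) / 2"
      using n by (simp add: n_def of_nat_diff field_simps)
    moreover have "2 \<le> card (- {\<sigma> i})"
      using n card by simp
    ultimately show ?thesis
      by (intro achievable_vertex[OF rec \<open>inj \<sigma>\<close> \<open>i \<noteq> j\<close>, where S = "- {\<sigma> i}"]) auto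
  qed
  have low: "l \<in> service_rate_region G"
    if "i \<noteq> j" "0 \<le> l $ i" "0 \<le> l $ j" "l $ j \<le> 1" "2 * l $ i + l $ j \<le> n + 1" for i j
  proof -
    let ?y = "l $ j"
    have other: "m \<noteq> i \<longleftrightarrow> m = j" for m
      using two_index_cases[OF \<open>i \<noteq> j\<close>, of m] \<open>i \<noteq> j\<close> by auto
    \<comment> \<open>The point of the segment whose \<open>j\<close>-th coordinate is \<open>l $ j\<close>.\<close>
    define p :: "real ^ 2" where
      "p = (1 - ?y) *\<^sub>R (\<chi> m. if m = i then (n + 1) / 2 else 0) + ?y *\<^sub>R (\<chi> m. if m = i then n / 2 else 1)"
    have "p \<in> service_rate_region G"
      unfolding p_def
      by (rule convexD[OF convex_service_rate_region axis_vertex corner]) (use that in auto)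
    moreover have "l $ m \<le> p $ m" "0 \<le> l $ m" for m
      using that other[of m] by (auto simp: p_def field_simps)
    ultimately show ?thesis
      using service_rate_region_down_closed by blast
  qed
  consider "l $ 2 \<le> 1" | "l $ 1 \<le> 1" | "1 < l $ 1" "1 < l $ 2"
    by linarith
  then show "l \<in> service_rate_region G"
  proof cases
    case 1
    then show ?thesis
      using l low[of 1 2] by (simp add: rate_polygon_def n_def)
  next
    case 2
    then show ?thesis
      using l low[of 2 1] by (simp add: rate_polygon_def n_def)
  next
    case 3
    \<comment> \<open>The weight for which the point between the two corners has first coordinate \<open>l $ 1\<close>.\<close>
    define u where "u = (l $ 1 - 1) / (n / 2 - 1)"
    have sum_le: "2 * l $ 1 + 2 * l $ 2 \<le> n + 2"
      using l by (simp add: rate_polygon_def n_def)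
    have u: "0 \<le> u" "u \<le> 1"
      using 3 n4 sum_le by (simp_all add: u_def divide_simps)
    have u_eq: "u * (n / 2 - 1) = l $ 1 - 1"
      using n4 by (simp add: u_def)
    define p :: "real ^ 2" where
      "p = u *\<^sub>R (\<chi> m. if m = 1 then n / 2 else 1) + (1 - u) *\<^sub>R (\<chi> m. if m = 2 then n / 2 else 1)"
    have "p \<in> service_rate_region G"
      unfolding p_def by (rule convexD[OF convex_service_rate_region corner corner]) (use u in auto)
    moreover have "p $ 1 = l $ 1" "p $ 2 = n / 2 + 1 - l $ 1"
      using u_eq by (simp_all add: p_def algebra_simps)
    then have "l $ m \<le> p $ m" "0 \<le> l $ m" for m
      using 3 sum_le exhaust_2[of m] by auto
    ultimately show ?thesis
      using service_rate_region_down_closed by blast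
  qed
qed

section \<open>The area of the polygon\<close>

lemma mem_triangle_2_iff:
  fixes a b c :: "real ^ 2"
  shows "l \<in> convex hull {a, b, c} \<longleftrightarrow>
    (\<exists>u v w. (l $ 1 = u * a $ 1 + v * b $ 1 + w * c $ 1 \<and> l $ 2 = u * a $ 2 + v * b $ 2 + w * c $ 2) \<and>
       0 \<le> u \<and> 0 \<le> v \<and> 0 \<le> w \<and> u + v + w = 1)"
  unfolding convex_hull_3 mem_Collect_eq vec_eq_iff forall_2 by simp

lemma mem_triangle_2I:
  fixes a b c :: "real ^ 2"
  assumes "0 \<le> u" "0 \<le> v" "0 \<le> w" "u + v + w = 1"
    and "l $ 1 = u * a $ 1 + v * b $ 1 + w * c $ 1" "l $ 2 = u * a $ 2 + v * b $ 2 + w * c $ 2"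
  shows "l \<in> convex hull {a, b, c}"
  unfolding mem_triangle_2_iff using assms by blast

lemma content_triangle_lebesgue:
  fixes a b c :: "real ^ 2"
  shows "measure lebesgue (convex hull {a, b, c})
    = \<bar>(c $ 1 - a $ 1) * (b $ 2 - a $ 2) - (b $ 1 - a $ 1) * (c $ 2 - a $ 2)\<bar> / 2"
proof -
  have "convex hull {a, b, c} \<in> sets borel"
    by (intro borel_compact finite_imp_compact_convex_hull) auto
  then show ?thesis
    by (simp add: content_triangle measure_completion)
qed

lemma negligible_line_2:
  fixes a b c :: real
  assumes "a \<noteq> 0 \<or> b \<noteq> 0"
  shows "negligible {l :: real ^ 2. a * l $ 1 + b * l $ 2 = c}"
proof -
  have "(vector [a, b] :: real ^ 2) \<noteq> 0"
    using assms by (auto simp: vec_eq_iff forall_2)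
  then have "negligible {l. (vector [a, b] :: real ^ 2) \<bullet> l = c}"
    using negligible_hyperplane by blast
  then show ?thesis
    by (simp add: inner_vec_def sum_2)
qed

lemma convex_rate_polygon: "convex (rate_polygon n)"
proof -
  have halfplane: "convex {l :: real ^ 2. a * l $ 1 + b * l $ 2 \<le> c}" for a b c :: real
    using convex_halfspace_le[of "vector [a, b] :: real ^ 2" c] by (simp add: inner_vec_def sum_2)
  have "rate_polygon n = {l. -1 * l $ 1 + 0 * l $ 2 \<le> 0} \<inter> {l. 0 * l $ 1 + -1 * l $ 2 \<le> 0}
      \<inter> {l. 2 * l $ 1 + 2 * l $ 2 \<le> n + 2} \<inter> {l. 2 * l $ 1 + 1 * l $ 2 \<le> n + 1}
      \<inter> {l. 1 * l $ 1 + 2 * l $ 2 \<le> n + 1}"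
    by (auto simp: rate_polygon_def)
  then show ?thesis
    by (simp only:) (intro convex_Int halfplane)
qed

lemma bounded_rate_polygon: "bounded (rate_polygon n)"
proof (rule bounded_subset[OF bounded_cbox])
  show "rate_polygon n \<subseteq> cbox 0 (\<chi> i. n + 2)"
    by (auto simp: rate_polygon_def mem_box_cart forall_2)
qed

text \<open>
  The half-planes \<open>2 l\<^sub>1 + l\<^sub>2 \<le> n + 1\<close> and \<open>l\<^sub>1 + 2 l\<^sub>2 \<le> n + 1\<close> cut two corner triangles off the
  right triangle with legs \<open>(n + 2) / 2\<close>. Each corner triangle has base \<open>1 / 2\<close> on an axis and
  height \<open>1\<close>, which leaves \<open>(n + 2)\<^sup>2 / 8 - 1 / 2\<close>. The bound on \<open>n\<close>
  keeps the corner triangles from overlapping.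
\<close>

lemma measure_rate_polygon:
  assumes "2 \<le> n"
  shows "measure lebesgue (rate_polygon n) = (n\<^sup>2 + 4 * n) / 8"
proof -
  let ?P = "rate_polygon n"
  define T where "T = convex hull {vector [0, 0], vector [(n + 2) / 2, 0], vector [0, (n + 2) / 2] :: real ^ 2}"
  define C1 where "C1 = convex hull {vector [(n + 1) / 2, 0], vector [(n + 2) / 2, 0], vector [n / 2, 1] :: real ^ 2}"
  define C2 where "C2 = convex hull {vector [0, (n + 1) / 2], vector [0, (n + 2) / 2], vector [1, n / 2] :: real ^ 2}"
  have T: "l \<in> T \<longleftrightarrow> 0 \<le> l $ 1 \<and> 0 \<le> l $ 2 \<and> 2 * l $ 1 + 2 * l $ 2 \<le> n + 2" (is "_ \<longleftrightarrow> ?R") for l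
  proof
    assume "l \<in> T"
    then obtain u v w where uvw: "0 \<le> u" "0 \<le> v" "0 \<le> w" "u + v + w = 1"
      and l: "l $ 1 = v * ((n + 2) / 2)" "l $ 2 = w * ((n + 2) / 2)"
      unfolding T_def mem_triangle_2_iff by auto
    have "(v + w) * (n + 2) \<le> 1 * (n + 2)"
      using uvw assms by (intro mult_right_mono) auto
    then have "2 * l $ 1 + 2 * l $ 2 \<le> n + 2"
      using l by (simp add: algebra_simps)
    moreover have "0 \<le> l $ 1" "0 \<le> l $ 2"
      unfolding l using uvw assms by (auto intro!: mult_nonneg_nonneg)
    ultimately show ?R
      by blast
  next
    assume ?R
    then have "(2 * l $ 1 + 2 * l $ 2) / (n + 2) \<le> 1"
      using assms by simp
    then have "0 \<le> 1 - 2 * l $ 1 / (n + 2) - 2 * l $ 2 / (n + 2)"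
      unfolding add_divide_distrib by linarith
    then show "l \<in> T"
      unfolding T_def using \<open>?R\<close> assms
      by (intro mem_triangle_2I[of "1 - 2 * l $ 1 / (n + 2) - 2 * l $ 2 / (n + 2)"
            "2 * l $ 1 / (n + 2)" "2 * l $ 2 / (n + 2)"]) auto
  qed
  have C1: "l \<in> C1 \<longleftrightarrow> 0 \<le> l $ 2 \<and> 2 * l $ 1 + 2 * l $ 2 \<le> n + 2 \<and> n + 1 \<le> 2 * l $ 1 + l $ 2"
    (is "_ \<longleftrightarrow> ?R") for l
  proof
    assume "l \<in> C1"
    then obtain u v w where uvw: "0 \<le> u" "0 \<le> v" "0 \<le> w" "u + v + w = 1"
      and l: "l $ 1 = u * ((n + 1) / 2) + v * ((n + 2) / 2) + w * (n / 2)" "l $ 2 = w"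
      unfolding C1_def mem_triangle_2_iff by auto
    have u: "u = 1 - v - w"
      using uvw by linarith
    have "2 * l $ 1 = n + 1 + v - w"
      unfolding l u by (simp add: field_simps)
    then show ?R
      using uvw l by auto
  next
    assume ?R
    then show "l \<in> C1"
      unfolding C1_def
      by (intro mem_triangle_2I[of "n + 2 - 2 * l $ 1 - 2 * l $ 2" "2 * l $ 1 + l $ 2 - (n + 1)" "l $ 2"])
        (auto simp: field_simps)
  qed
  have C2: "l \<in> C2 \<longleftrightarrow> 0 \<le> l $ 1 \<and> 2 * l $ 1 + 2 * l $ 2 \<le> n + 2 \<and> n + 1 \<le> l $ 1 + 2 * l $ 2"
    (is "_ \<longleftrightarrow> ?R") for l
  proof
    assume "l \<in> C2"
    then obtain u v w where uvw: "0 \<le> u" "0 \<le> v" "0 \<le> w" "u + v + w = 1"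
      and l: "l $ 2 = u * ((n + 1) / 2) + v * ((n + 2) / 2) + w * (n / 2)" "l $ 1 = w"
      unfolding C2_def mem_triangle_2_iff by auto
    have u: "u = 1 - v - w"
      using uvw by linarith
    have "2 * l $ 2 = n + 1 + v - w"
      unfolding l u by (simp add: field_simps)
    then show ?R
      using uvw l by auto
  next
    assume ?R
    then show "l \<in> C2"
      unfolding C2_def
      by (intro mem_triangle_2I[of "n + 2 - 2 * l $ 1 - 2 * l $ 2" "l $ 1 + 2 * l $ 2 - (n + 1)" "l $ 1"])
        (auto simp: field_simps)
  qed
  have bounded: "bounded T" "bounded C1" "bounded C2"
    unfolding T_def C1_def C2_def by (auto intro!: bounded_convex_hull)
  have "measure lebesgue T = measure lebesgue ?P + measure lebesgue C1 + measure lebesgue C2"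
  proof (rule measure_Un3_negligible)
    show "?P \<in> lmeasurable" "C1 \<in> lmeasurable" "C2 \<in> lmeasurable"
      using convex_rate_polygon bounded_rate_polygon bounded by (auto intro!: measurable_convex simp: C1_def C2_def)
    have "negligible {l :: real ^ 2. 2 * l $ 1 + 1 * l $ 2 = n + 1}"
      by (rule negligible_line_2) simp
    then show "negligible (?P \<inter> C1)"
      by (rule negligible_subset) (auto simp: rate_polygon_def C1)
    have "negligible {l :: real ^ 2. 1 * l $ 1 + 2 * l $ 2 = n + 1}"
      by (rule negligible_line_2) simp
    then show "negligible (?P \<inter> C2)"
      by (rule negligible_subset) (auto simp: rate_polygon_def C2)
    \<comment> \<open>The two corner triangles are disjoint unless \<open>n = 2\<close>, when they share just the point \<open>(1, 1)\<close>.\<close>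
    have "negligible {l :: real ^ 2. 1 * l $ 1 + 0 * l $ 2 = 1}"
      by (rule negligible_line_2) simp
    then show "negligible (C1 \<inter> C2)"
      by (rule negligible_subset) (use assms in \<open>auto simp: C1 C2\<close>)
    show "?P \<union> C1 \<union> C2 = T"
      using assms by (auto simp: rate_polygon_def T C1 C2)
  qed
  moreover have "measure lebesgue T = (n + 2)\<^sup>2 / 8"
    using assms by (simp add: T_def content_triangle_lebesgue power2_eq_square)
  moreover have "measure lebesgue C1 = 1 / 4" "measure lebesgue C2 = 1 / 4"
    by (simp_all add: C1_def C2_def content_triangle_lebesgue field_simps)
  ultimately show ?thesis
    by (simp add: power2_eq_square field_simps)
qed

section \<open>The volume of the service rate region\<close>

lemma vol_convex:
  assumes "convex S" and "bounded S"
  shows "vol S = measure lebesgue S"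
  unfolding vol_def using measure_interior[OF assms(2) negligible_convex_frontier[OF assms(1)]] .

theorem theorem6p3:
  fixes G :: "'a::{field,finite} ^ 'n::{finite,linorder} ^ 2"
  assumes "systematic G" and "MDS_matrix G" and "CARD('n) \<ge> 4"
  shows "vol (service_rate_region G) = (real CARD('n) ^ 2 + 4 * real CARD('n)) / 8"
proof -
  obtain \<sigma> :: "2 \<Rightarrow> 'n" where "strict_mono \<sigma>" and "(\<chi> i j. G $ i $ \<sigma> j) = mat 1"
    using assms(1) unfolding systematic_def by blast
  then have inj: "inj \<sigma>" and sys: "\<And>i j. G $ i $ \<sigma> j = (if i = j then 1 else 0)"
    by (auto simp: strict_mono_imp_inj_on vec_eq_iff mat_def)
  have "recovery_sets G i = {R. \<sigma> i \<in> R \<or> 2 \<le> card R}" for i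
    using recovery_sets_systematic_MDS[OF sys MDS_imp_minor2_nonzero[OF assms(2) sys]] by blast
  then have "service_rate_region G = rate_polygon (real CARD('n))"
    using service_rate_region_eq_rate_polygon[OF _ inj assms(3)] by blast
  moreover have "2 \<le> real CARD('n)"
    using assms(3) by simp
  ultimately show ?thesis
    by (simp add: vol_convex convex_rate_polygon bounded_rate_polygon measure_rate_polygon)
qed

end
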